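(* Let $d\ge 2$ be an integer and let $\mathcal F_{\exp}=\langle F;+,\cdot,0,1,<,\exp\rangle$ be an expansion of an ordered field by a unary function $\exp:F\to F$. Let $\mathcal G_{\exp}=\langle F^d;\mathsf{Bw},O,E_1,\dots,E_d,\Gamma_{\exp}\rangle$, where for $x,p,q\in F^d$: $O(x)\iff x=(0,\dots,0)$; $E_i(x)\iff x=e_i$ (the $i$th standard basis point); and $$\Gamma_{\exp}(p,q)\iff (p_2=\cdots=p_d=0)\wedge(q_1=q_3=\cdots=q_d=0)\wedge (q_2=\exp(p_1)).$$ Then $\mathcal G_{\exp}$ is semilinearly faithful over $\mathcal F_{\exp}$.
   Context: $\exp$ is just the interpretation of a unary function symbol; no further axioms are assumed (the motivating case is $F=\mathbb R$ with the usual exponential). $\mathsf{Bw}$ is the betweenness relation on $F^d$: $\mathsf{Bw}(a,b,c)\iff\exists t\in F\,(0\le t\le 1\wedge b=(1-t)a+tc)$. For an ultrafilter $U$ on a set $I$, $\mathcal F_{\exp}^U$ is the ultrapower of $\mathcal F_{\exp}$, with universe $F^U$, and $\mathcal G_{\exp}(\mathcal F_{\exp}^U)$ is the structure on $(F^U)^d$ in the same relational language in which each relation is defined in $\mathcal F_{\exp}^U$ by the same formula that defines it in $\mathcal F_{\exp}$. Affine maps of $(F^U)^d$ are maps $x\mapsto Ax+b$ with $A\in\mathrm{GL}_d(F^U)$, $b\in(F^U)^d$; $\mathrm{AffAut}(\mathcal G_{\exp}(\mathcal F_{\exp}^U))$ is the group of automorphisms of $\mathcal G_{\exp}(\mathcal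 F_{\exp}^U)$ that are affine. $\mathcal G_{\exp}$ is semilinearly faithful over $\mathcal F_{\exp}$ if for every ultrafilter $U$ (on any set) and every $\alpha\in\mathrm{Aut}(\mathcal G_{\exp}(\mathcal F_{\exp}^U))$ there exist $A\in\mathrm{AffAut}(\mathcal G_{\exp}(\mathcal F_{\exp}^U))$ and $\sigma\in\mathrm{Aut}(\mathcal F_{\exp}^U)$ (an ordered-field automorphism commuting with $\exp$) such that $\alpha=A\circ\widetilde\sigma$, where $\widetilde\sigma(x_1,\dots,x_d)=(\sigma(x_1),\dots,\sigma(x_d))$. *)

theory Defs
  imports "HOL-Algebra.Ring" "HOL-Algebra.Bij"
begin

section \<open>Ordered fields expanded by a unary function\<close>

record 'a exp_field = "'a ring" +
  lt :: "'a \<Rightarrow> 'a \<Rightarrow> bool"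
  expo :: "'a \<Rightarrow> 'a"

text \<open>No axiom on \<open>expo\<close> beyond closure: it only interprets a unary function symbol.\<close>

locale ordered_exp_field = field F for F :: "'a exp_field" (structure) +
  assumes lt_irrefl: "x \<in> carrier F \<Longrightarrow> \<not> lt F x x"
    and lt_trans: "\<lbrakk>x \<in> carrier F; y \<in> carrier F; z \<in> carrier F; lt F x y; lt F y z\<rbrakk>
      \<Longrightarrow> lt F x z"
    and lt_total: "\<lbrakk>x \<in> carrier F; y \<in> carrier F\<rbrakk> \<Longrightarrow> lt F x y \<or> x = y \<or> lt F y x"
    and lt_add: "\<lbrakk>x \<in> carrier F; y \<in> carrier F; z \<in> carrier F; lt F x y\<rbrakk>
      \<Longrightarrow> lt F (x \<oplus> z) (y \<oplus> z)"
    and lt_mult: "\<lbrakk>x \<in> carrier F; y \<in> carrier F; lt F \<zero> x; lt F \<zero> y\<rbrakk>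
      \<Longrightarrow> lt F \<zero> (x \<otimes> y)"
    and expo_closed: "x \<in> carrier F \<Longrightarrow> expo F x \<in> carrier F"

definition le :: "'a exp_field \<Rightarrow> 'a \<Rightarrow> 'a \<Rightarrow> bool" where
  "le F x y \<longleftrightarrow> lt F x y \<or> x = y"

text \<open>As in \<^const>\<open>Bij\<close>, permutations of a carrier are kept extensional, so that equality of
  functions is equality on the carrier.\<close>

definition field_Aut :: "'a exp_field \<Rightarrow> ('a \<Rightarrow> 'a) set" where
  "field_Aut F = {\<sigma> \<in> Bij (carrier F). \<sigma> \<in> ring_hom F F \<and>
     (\<forall>x\<in>carrier F. \<forall>y\<in>carrier F. lt F x y \<longleftrightarrow> lt F (\<sigma> x) (\<sigma> y)) \<and>
     (\<forall>x\<in>carrier F. \<sigma> (expo F x) = expo F (\<sigma> x))}"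


section \<open>Ultrapowers\<close>

definition ultrafilter_on :: "'i set \<Rightarrow> 'i set set \<Rightarrow> bool" where
  "ultrafilter_on I U \<longleftrightarrow>
     U \<subseteq> Pow I \<and> I \<in> U \<and> {} \<notin> U \<and>
     (\<forall>A\<in>U. \<forall>B\<in>U. A \<inter> B \<in> U) \<and>
     (\<forall>A\<in>U. \<forall>B. A \<subseteq> B \<and> B \<subseteq> I \<longrightarrow> B \<in> U) \<and>
     (\<forall>A. A \<subseteq> I \<longrightarrow> A \<in> U \<or> I - A \<in> U)"

definition ultra_rel :: "'i set \<Rightarrow> 'i set set \<Rightarrow> 'a exp_field \<Rightarrow> (('i \<Rightarrow> 'a) \<times> ('i \<Rightarrow> 'a)) set" where
  "ultra_rel I U F =
     {(f, g). f \<in> I \<rightarrow>\<^sub>E carrier F \<and> g \<in> I \<rightarrow>\<^sub>E carrier F \<and> {i \<in> I. f i = g i} \<in> U}"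

abbreviation ultra_class :: "'i set \<Rightarrow> 'i set set \<Rightarrow> 'a exp_field \<Rightarrow> ('i \<Rightarrow> 'a) \<Rightarrow> ('i \<Rightarrow> 'a) set" where
  "ultra_class I U F f \<equiv> ultra_rel I U F `` {f}"

text \<open>The unions below run over representatives; the classes united all coincide.\<close>

definition ultrapower :: "'i set \<Rightarrow> 'i set set \<Rightarrow> 'a exp_field \<Rightarrow> ('i \<Rightarrow> 'a) set exp_field" where
  "ultrapower I U F = \<lparr>
     carrier = (I \<rightarrow>\<^sub>E carrier F) // ultra_rel I U F,
     mult = (\<lambda>X Y. \<Union>f\<in>X. \<Union>g\<in>Y. ultra_class I U F (\<lambda>i\<in>I. f i \<otimes>\<^bsub>F\<^esub> g i)),
     one = ultra_class I U F (\<lambda>i\<in>I. \<one>\<^bsub>F\<^esub>),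
     zero = ultra_class I U F (\<lambda>i\<in>I. \<zero>\<^bsub>F\<^esub>),
     add = (\<lambda>X Y. \<Union>f\<in>X. \<Union>g\<in>Y. ultra_class I U F (\<lambda>i\<in>I. f i \<oplus>\<^bsub>F\<^esub> g i)),
     lt = (\<lambda>X Y. \<exists>f\<in>X. \<exists>g\<in>Y. {i \<in> I. lt F (f i) (g i)} \<in> U),
     expo = (\<lambda>X. \<Union>f\<in>X. ultra_class I U F (\<lambda>i\<in>I. expo F (f i)))\<rparr>"


section \<open>Relational structures and their automorphisms\<close>

text \<open>A relation is the set of argument lists satisfying it.\<close>

record ('s, 'v) rel_structure =
  universe :: "'v set"
  symbols :: "'s set"
  rel :: "'s \<Rightarrow> 'v list set"

definition Aut :: "('s, 'v) rel_structure \<Rightarrow> ('v \<Rightarrow> 'v) set" where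
  "Aut G = {\<alpha> \<in> Bij (universe G).
     \<forall>s\<in>symbols G. \<forall>xs\<in>lists (universe G). xs \<in> rel G s \<longleftrightarrow> map \<alpha> xs \<in> rel G s}"


section \<open>Affine and coordinatewise maps of \<open>F\<^sup>d\<close>\<close>

text \<open>Points of \<open>F\<^sup>d\<close> are functions with domain \<open>{1..d}\<close>.\<close>

definition pow_space :: "nat \<Rightarrow> 'a exp_field \<Rightarrow> (nat \<Rightarrow> 'a) set" where
  "pow_space d F = {1..d} \<rightarrow>\<^sub>E carrier F"

definition mats :: "nat \<Rightarrow> 'a exp_field \<Rightarrow> (nat \<Rightarrow> nat \<Rightarrow> 'a) set" where
  "mats d F = {1..d} \<rightarrow>\<^sub>E ({1..d} \<rightarrow>\<^sub>E carrier F)"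

definition mat_mult ::
    "nat \<Rightarrow> 'a exp_field \<Rightarrow> (nat \<Rightarrow> nat \<Rightarrow> 'a) \<Rightarrow> (nat \<Rightarrow> nat \<Rightarrow> 'a) \<Rightarrow> nat \<Rightarrow> nat \<Rightarrow> 'a" where
  "mat_mult d F M N =
     (\<lambda>i\<in>{1..d}. \<lambda>j\<in>{1..d}. \<Oplus>\<^bsub>F\<^esub>k\<in>{1..d}. M i k \<otimes>\<^bsub>F\<^esub> N k j)"

definition mat_one :: "nat \<Rightarrow> 'a exp_field \<Rightarrow> nat \<Rightarrow> nat \<Rightarrow> 'a" where
  "mat_one d F = (\<lambda>i\<in>{1..d}. \<lambda>j\<in>{1..d}. if i = j then \<one>\<^bsub>F\<^esub> else \<zero>\<^bsub>F\<^esub>)"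

definition GL :: "nat \<Rightarrow> 'a exp_field \<Rightarrow> (nat \<Rightarrow> nat \<Rightarrow> 'a) set" where
  "GL d F = {M \<in> mats d F. \<exists>N\<in>mats d F.
     mat_mult d F M N = mat_one d F \<and> mat_mult d F N M = mat_one d F}"

definition affine_map ::
    "nat \<Rightarrow> 'a exp_field \<Rightarrow> (nat \<Rightarrow> nat \<Rightarrow> 'a) \<Rightarrow> (nat \<Rightarrow> 'a) \<Rightarrow> (nat \<Rightarrow> 'a) \<Rightarrow> nat \<Rightarrow> 'a" where
  "affine_map d F M b =
     (\<lambda>x\<in>pow_space d F. \<lambda>i\<in>{1..d}. (\<Oplus>\<^bsub>F\<^esub>j\<in>{1..d}. M i j \<otimes>\<^bsub>F\<^esub> x j) \<oplus>\<^bsub>F\<^esub> b i)"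

definition coordinatewise :: "nat \<Rightarrow> 'a exp_field \<Rightarrow> ('a \<Rightarrow> 'a) \<Rightarrow> (nat \<Rightarrow> 'a) \<Rightarrow> nat \<Rightarrow> 'a" where
  "coordinatewise d F \<sigma> = (\<lambda>x\<in>pow_space d F. \<lambda>i\<in>{1..d}. \<sigma> (x i))"

definition AffAut ::
    "nat \<Rightarrow> 'a exp_field \<Rightarrow> ('s, nat \<Rightarrow> 'a) rel_structure \<Rightarrow> ((nat \<Rightarrow> 'a) \<Rightarrow> nat \<Rightarrow> 'a) set" where
  "AffAut d F G = {\<alpha> \<in> Aut G. \<exists>M\<in>GL d F. \<exists>b\<in>pow_space d F. \<alpha> = affine_map d F M b}"


section \<open>Semilinear faithfulness\<close>

text \<open>The argument \<open>G\<close> is the interpretation scheme: it maps a structure in the language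
  of \<open>F\<close> to the relational structure on its \<open>d\<close>-th power whose relations are defined by the
  fixed defining formulas, so \<open>G (ultrapower I U F)\<close> uses the same formulas as \<open>G\<close> over \<open>F\<close>.
  The index sets \<open>I\<close> are the sets over the type \<open>'i\<close>; the first argument lets a theorem
  be stated for all types \<open>'i\<close>.\<close>

definition semilinearly_faithful ::
    "'i itself \<Rightarrow> nat \<Rightarrow>
     (('i \<Rightarrow> 'a) set exp_field \<Rightarrow> ('s, nat \<Rightarrow> ('i \<Rightarrow> 'a) set) rel_structure) \<Rightarrow>
     'a exp_field \<Rightarrow> bool" where
  "semilinearly_faithful T d G F \<longleftrightarrow>
     (\<forall>(I :: 'i set) U. ultrafilter_on I U \<longrightarrow>
       (let K = ultrapower I U F in
         \<forall>\<alpha>\<in>Aut (G K). \<exists>A\<in>AffAut d K (G K). \<exists>\<sigma>\<in>field_Aut K.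
           \<alpha> = compose (pow_space d K) A (coordinatewise d K \<sigma>)))"


section \<open>The structure \<open>\<langle>F\<^sup>d; Bw, O, E\<^sub>1, \<dots>, E\<^sub>d, \<Gamma>\<rangle>\<close>\<close>

datatype geom_symbol = BwSym | OSym | ESym nat | GammaSym

definition Bw :: "nat \<Rightarrow> 'a exp_field \<Rightarrow> (nat \<Rightarrow> 'a) \<Rightarrow> (nat \<Rightarrow> 'a) \<Rightarrow> (nat \<Rightarrow> 'a) \<Rightarrow> bool" where
  "Bw d F a b c \<longleftrightarrow>
     (\<exists>t\<in>carrier F. le F \<zero>\<^bsub>F\<^esub> t \<and> le F t \<one>\<^bsub>F\<^esub> \<and>
       (\<forall>i\<in>{1..d}. b i = (\<one>\<^bsub>F\<^esub> \<ominus>\<^bsub>F\<^esub> t) \<otimes>\<^bsub>F\<^esub> a i \<oplus>\<^bsub>F\<^esub> t \<otimes>\<^bsub>F\<^esub> c i))"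

definition Origin :: "nat \<Rightarrow> 'a exp_field \<Rightarrow> (nat \<Rightarrow> 'a) \<Rightarrow> bool" where
  "Origin d F x \<longleftrightarrow> (\<forall>j\<in>{1..d}. x j = \<zero>\<^bsub>F\<^esub>)"

definition Basis_pt :: "nat \<Rightarrow> 'a exp_field \<Rightarrow> nat \<Rightarrow> (nat \<Rightarrow> 'a) \<Rightarrow> bool" where
  "Basis_pt d F i x \<longleftrightarrow> (\<forall>j\<in>{1..d}. x j = (if j = i then \<one>\<^bsub>F\<^esub> else \<zero>\<^bsub>F\<^esub>))"

definition Gamma_exp :: "nat \<Rightarrow> 'a exp_field \<Rightarrow> (nat \<Rightarrow> 'a) \<Rightarrow> (nat \<Rightarrow> 'a) \<Rightarrow> bool" where
  "Gamma_exp d F p q \<longleftrightarrow>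
     (\<forall>j\<in>{1..d} - {1}. p j = \<zero>\<^bsub>F\<^esub>) \<and>
     (\<forall>j\<in>{1..d} - {2}. q j = \<zero>\<^bsub>F\<^esub>) \<and>
     q 2 = expo F (p 1)"

definition G_exp :: "nat \<Rightarrow> 'a exp_field \<Rightarrow> (geom_symbol, nat \<Rightarrow> 'a) rel_structure" where
  "G_exp d F = \<lparr>
     universe = pow_space d F,
     symbols = {BwSym, OSym, GammaSym} \<union> ESym ` {1..d},
     rel = (\<lambda>s. case s of
         BwSym \<Rightarrow> {[a, b, c] | a b c. {a, b, c} \<subseteq> pow_space d F \<and> Bw d F a b c}
       | OSym \<Rightarrow> {[x] | x. x \<in> pow_space d F \<and> Origin d F x}
       | ESym i \<Rightarrow> {[x] | x. x \<in> pow_space d F \<and> Basis_pt d F i x}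
       | GammaSym \<Rightarrow> {[p, q] | p q. {p, q} \<subseteq> pow_space d F \<and> Gamma_exp d F p q})\<rparr>"

end

theory Submission
  imports Defs
begin

text \<open>The ultrapower \<open>K\<close> is again an ordered field with a unary function, so it suffices to
  treat automorphisms \<open>\<alpha>\<close> of the geometry over an arbitrary such \<open>K\<close>. Betweenness defines
  collinearity, and collinearity defines, for \<open>x\<close> and \<open>y\<close> not collinear with \<open>0\<close>, the fourth vertex
  \<open>x + y\<close> of a parallelogram. As \<open>\<alpha>\<close> fixes \<open>0\<close>, it is therefore additive (for collinear summands
  add an auxiliary independent vector), and it maps lines through \<open>0\<close> to lines through \<open>0\<close>. Hence
  \<open>\<alpha> (t e\<^sub>i) = \<sigma> t e\<^sub>i\<close>; the line through \<open>e\<^sub>1 + e\<^sub>i\<close> shows that \<open>\<sigma>\<close> does not depend on \<open>i\<close>, and the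
  line through \<open>e\<^sub>1 + t e\<^sub>2\<close> that \<open>\<sigma>\<close> is multiplicative. Betweenness on the first axis and the
  relation \<open>\<Gamma>\<close> make \<open>\<sigma>\<close> preserve the order and \<open>exp\<close>. So \<open>\<alpha>\<close> is \<open>\<sigma>\<close> applied coordinatewise, with
  trivial affine part.\<close>

section \<open>Ultrapowers of ordered fields with a unary function\<close>

locale ultrapower_setup = ordered_exp_field F for F :: "'a exp_field" (structure) +
  fixes I :: "'i set" and U :: "'i set set"
  assumes ultrafilter: "ultrafilter_on I U"
begin

abbreviation "seqs \<equiv> I \<rightarrow>\<^sub>E carrier F"
abbreviation "cls \<equiv> ultra_class I U F"
abbreviation "K \<equiv> ultrapower I U F"

section \<open>Properties that hold on a set of the ultrafilter\<close>

definition ev :: "('i \<Rightarrow> bool) \<Rightarrow> bool" where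
  "ev P \<longleftrightarrow> {i \<in> I. P i} \<in> U"

lemma ev_cong [cong]: "(\<And>i. i \<in> I \<Longrightarrow> P i = Q i) \<Longrightarrow> ev P = ev Q"
  unfolding ev_def by (metis (mono_tags, lifting) Collect_cong)

lemma ev_True [simp]: "ev (\<lambda>i. True)"
  using ultrafilter by (simp add: ev_def ultrafilter_on_def)

lemma ev_False [simp]: "\<not> ev (\<lambda>i. False)"
  using ultrafilter by (simp add: ev_def ultrafilter_on_def)

lemma ev_mono: "\<lbrakk>ev P; \<And>i. \<lbrakk>i \<in> I; P i\<rbrakk> \<Longrightarrow> Q i\<rbrakk> \<Longrightarrow> ev Q"
  using ultrafilter unfolding ev_def ultrafilter_on_def
  by (metis (no_types, lifting) Collect_subset mem_Collect_eq subsetI)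

lemma ev_conj: "ev P \<Longrightarrow> ev Q \<Longrightarrow> ev (\<lambda>i. P i \<and> Q i)"
proof -
  assume "ev P" "ev Q"
  then have "{i \<in> I. P i} \<inter> {i \<in> I. Q i} \<in> U"
    using ultrafilter by (simp add: ev_def ultrafilter_on_def)
  moreover have "{i \<in> I. P i} \<inter> {i \<in> I. Q i} = {i \<in> I. P i \<and> Q i}"
    by blast
  ultimately show ?thesis
    by (simp add: ev_def)
qed

lemma ev_mono2: "\<lbrakk>ev P; ev Q; \<And>i. \<lbrakk>i \<in> I; P i; Q i\<rbrakk> \<Longrightarrow> R i\<rbrakk> \<Longrightarrow> ev R"
  using ev_mono[OF ev_conj[of P Q]] by blast

text \<open>Here the maximality of \<open>U\<close> enters: a set or its complement belongs to it.
  Through this lemma and \<open>ev_disj\<close> it yields inverses and totality of the order in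
  \<open>K\<close>.\<close>

lemma ev_not: "\<not> ev P \<Longrightarrow> ev (\<lambda>i. \<not> P i)"
proof -
  assume "\<not> ev P"
  moreover have "{i \<in> I. P i} \<in> U \<or> I - {i \<in> I. P i} \<in> U"
    using ultrafilter by (simp add: ultrafilter_on_def)
  moreover have "I - {i \<in> I. P i} = {i \<in> I. \<not> P i}"
    by blast
  ultimately show ?thesis
    by (simp add: ev_def)
qed

lemma ev_disj: "ev (\<lambda>i. P i \<or> Q i) \<Longrightarrow> ev P \<or> ev Q"
  using ev_mono2[of "\<lambda>i. P i \<or> Q i" "\<lambda>i. \<not> P i" Q] ev_not by blast

section \<open>Elements of the ultrapower as classes of sequences\<close>

lemma equiv_ultra_rel: "equiv seqs (ultra_rel I U F)"
proof (rule equivI)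
  show "ultra_rel I U F \<subseteq> seqs \<times> seqs"
    by (auto simp: ultra_rel_def)
  show "refl_on seqs (ultra_rel I U F)"
    using ultrafilter by (auto simp: refl_on_def ultra_rel_def ultrafilter_on_def)
  show "sym (ultra_rel I U F)"
    by (auto simp: sym_def ultra_rel_def eq_commute)
  show "trans (ultra_rel I U F)"
  proof (rule transI)
    fix f g h assume "(f, g) \<in> ultra_rel I U F" "(g, h) \<in> ultra_rel I U F"
    then show "(f, h) \<in> ultra_rel I U F"
      using ev_mono2[of "\<lambda>i. f i = g i" "\<lambda>i. g i = h i" "\<lambda>i. f i = h i"]
      by (auto simp: ultra_rel_def ev_def)
  qed
qed

lemma cls_eq_iff:
  assumes "f \<in> seqs" "g \<in> seqs"
  shows "cls f = cls g \<longleftrightarrow> ev (\<lambda>i. f i = g i)"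
  using eq_equiv_class_iff[OF equiv_ultra_rel assms] assms
  by (simp add: ultra_rel_def ev_def)

lemma mem_clsD: "f' \<in> cls f \<Longrightarrow> f' \<in> seqs \<and> f \<in> seqs \<and> ev (\<lambda>i. f i = f' i)"
  by (simp add: ultra_rel_def ev_def)

lemma mem_cls_self: "f \<in> seqs \<Longrightarrow> f \<in> cls f"
  by (rule equiv_class_self[OF equiv_ultra_rel])

lemma carrier_K: "carrier K = seqs // ultra_rel I U F"
  by (simp add: ultrapower_def)

lemma carrier_cases:
  assumes "X \<in> carrier K"
  obtains f where "f \<in> seqs" "X = cls f"
  using assms by (auto simp: carrier_K elim: quotientE)

lemma cls_closed: "f \<in> seqs \<Longrightarrow> cls f \<in> carrier K"
  by (simp add: carrier_K quotientI)

text \<open>The operations in \<open>ultrapower\<close> are unions over representatives. Such a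
  union collapses to its value at \<open>f\<close> once the value is the same for all of the class,
  and the class contains \<open>f\<close>.\<close>

lemma UN_cls:
  assumes "f \<in> seqs" and "\<And>f'. f' \<in> cls f \<Longrightarrow> H f' = H f"
  shows "(\<Union>f'\<in>cls f. H f') = H f"
  using assms mem_cls_self by blast

lemma UN_cls_unop:
  assumes "\<And>x. x \<in> carrier F \<Longrightarrow> op x \<in> carrier F" and f: "f \<in> seqs"
  shows "(\<Union>f'\<in>cls f. cls (\<lambda>i\<in>I. op (f' i))) = cls (\<lambda>i\<in>I. op (f i))"
proof (rule UN_cls[OF f])
  fix f' assume "f' \<in> cls f"
  then have f': "f' \<in> seqs" "ev (\<lambda>i. f i = f' i)"
    using mem_clsD by blast+
  have "(\<lambda>i\<in>I. op (f' i)) \<in> seqs" "(\<lambda>i\<in>I. op (f i)) \<in> seqs"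
    using assms f' by (auto simp: PiE_iff)
  then show "cls (\<lambda>i\<in>I. op (f' i)) = cls (\<lambda>i\<in>I. op (f i))"
    by (simp add: cls_eq_iff) (rule ev_mono[OF f'(2)], simp)
qed

text \<open>Well-definedness: the two results agree wherever both pairs of representatives agree,
  and the intersection of two sets of \<open>U\<close> is in \<open>U\<close>.\<close>

lemma UN_cls_binop:
  assumes "\<And>x y. \<lbrakk>x \<in> carrier F; y \<in> carrier F\<rbrakk> \<Longrightarrow> op x y \<in> carrier F"
    and f: "f \<in> seqs" and g: "g \<in> seqs"
  shows "(\<Union>f'\<in>cls f. \<Union>g'\<in>cls g. cls (\<lambda>i\<in>I. op (f' i) (g' i)))
    = cls (\<lambda>i\<in>I. op (f i) (g i))"
proof -
  have eq: "cls (\<lambda>i\<in>I. op (f' i) (g' i)) = cls (\<lambda>i\<in>I. op (f i) (g i))"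
    if "f' \<in> cls f" "g' \<in> cls g" for f' g'
  proof -
    have f': "f' \<in> seqs" "ev (\<lambda>i. f i = f' i)" and g': "g' \<in> seqs" "ev (\<lambda>i. g i = g' i)"
      using that mem_clsD by blast+
    have "(\<lambda>i\<in>I. op (f' i) (g' i)) \<in> seqs" "(\<lambda>i\<in>I. op (f i) (g i)) \<in> seqs"
      using assms f' g' by (auto simp: PiE_iff)
    then show ?thesis
      by (simp add: cls_eq_iff) (rule ev_mono2[OF f'(2) g'(2)], simp)
  qed
  show ?thesis
    using eq mem_cls_self[OF f] mem_cls_self[OF g] by blast
qed

section \<open>Operations and order of the ultrapower computed on representatives\<close>

lemma mult_cls: "\<lbrakk>f \<in> seqs; g \<in> seqs\<rbrakk> \<Longrightarrow> cls f \<otimes>\<^bsub>K\<^esub> cls g = cls (\<lambda>i\<in>I. f i \<otimes> g i)"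
  by (simp add: ultrapower_def UN_cls_binop)

lemma add_cls: "\<lbrakk>f \<in> seqs; g \<in> seqs\<rbrakk> \<Longrightarrow> cls f \<oplus>\<^bsub>K\<^esub> cls g = cls (\<lambda>i\<in>I. f i \<oplus> g i)"
  by (simp add: ultrapower_def UN_cls_binop)

lemma expo_cls: "f \<in> seqs \<Longrightarrow> expo K (cls f) = cls (\<lambda>i\<in>I. expo F (f i))"
  by (simp add: ultrapower_def UN_cls_unop expo_closed)

lemma one_K: "\<one>\<^bsub>K\<^esub> = cls (\<lambda>i\<in>I. \<one>)"
  by (simp add: ultrapower_def)

lemma zero_K: "\<zero>\<^bsub>K\<^esub> = cls (\<lambda>i\<in>I. \<zero>)"
  by (simp add: ultrapower_def)

text \<open>In \<open>ultrapower\<close> the order asks for some pair of representatives. Any other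
  pair differs from it only off a set of \<open>U\<close>, so the choice is immaterial.\<close>

lemma lt_cls:
  assumes f: "f \<in> seqs" and g: "g \<in> seqs"
  shows "lt K (cls f) (cls g) \<longleftrightarrow> ev (\<lambda>i. lt F (f i) (g i))"
proof
  assume "lt K (cls f) (cls g)"
  then obtain f' g' where fg': "f' \<in> cls f" "g' \<in> cls g" and lt: "ev (\<lambda>i. lt F (f' i) (g' i))"
    by (auto simp: ultrapower_def ev_def)
  have "ev (\<lambda>i. f i = f' i \<and> g i = g' i)"
    using mem_clsD[OF fg'(1)] mem_clsD[OF fg'(2)] by (simp add: ev_conj)
  with lt show "ev (\<lambda>i. lt F (f i) (g i))"
    by (rule ev_mono2) simp
next
  assume "ev (\<lambda>i. lt F (f i) (g i))"
  then show "lt K (cls f) (cls g)"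
    using mem_cls_self[OF f] mem_cls_self[OF g] by (auto simp: ultrapower_def ev_def)
qed

text \<open>In effect the theorem of Los for atomic formulas: rewriting with these rules turns a
  statement about classes into a pointwise one under \<open>ev\<close>.\<close>

lemmas K_simps = mult_cls add_cls expo_cls one_K zero_K lt_cls cls_eq_iff cls_closed Pi_iff PiE_mem[where T = "\<lambda>_. carrier F" and S = I]

text \<open>Identities and implications transfer index by index. Two axioms need more: an inverse
  exists only at almost every index, and the pointwise trichotomy has to be split into one
  alternative by \<open>ev_disj\<close>.\<close>

lemma ordered_exp_field_ultrapower: "ordered_exp_field K"
proof -
  have abelian: "abelian_group K"
  proof (rule abelian_groupI)
    fix X assume "X \<in> carrier K"
    then obtain f where f: "f \<in> seqs" "X = cls f"
      by (rule carrier_cases)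
    define g where "g = (\<lambda>i\<in>I. \<ominus> f i)"
    have g: "g \<in> seqs"
      using f by (auto simp: g_def PiE_iff)
    have "(\<lambda>i\<in>I. g i \<oplus> f i) = (\<lambda>i\<in>I. \<zero>)"
      using f by (intro restrict_ext) (auto simp: g_def l_neg PiE_iff)
    then have "cls g \<oplus>\<^bsub>K\<^esub> X = \<zero>\<^bsub>K\<^esub>"
      using f g by (simp add: add_cls zero_K)
    then show "\<exists>Y\<in>carrier K. Y \<oplus>\<^bsub>K\<^esub> X = \<zero>\<^bsub>K\<^esub>"
      using cls_closed[OF g] by blast
  qed (auto elim!: carrier_cases del: equalityI simp: K_simps a_ac)
  have monoid: "comm_monoid K"
    by (rule comm_monoidI) (auto elim!: carrier_cases del: equalityI simp: K_simps m_ac)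
  interpret K: cring K
    by (rule cringI[OF abelian monoid]) (auto elim!: carrier_cases del: equalityI simp: K_simps l_distr)
  have "field K"
  proof (rule K.cring_fieldI2)
    show "\<zero>\<^bsub>K\<^esub> \<noteq> \<one>\<^bsub>K\<^esub>"
      by (simp add: K_simps)
  next
    fix X assume "X \<in> carrier K" "X \<noteq> \<zero>\<^bsub>K\<^esub>"
    then obtain f where f: "f \<in> seqs" "X = cls f" and "\<not> ev (\<lambda>i. f i = \<zero>)"
      by (auto elim!: carrier_cases del: equalityI simp: K_simps)
    then have nz: "ev (\<lambda>i. f i \<noteq> \<zero>)"
      using ev_not by blast
    \<comment> \<open>The default zero keeps \<open>?g\<close> inside the carrier at indices where
      \<open>f\<close> vanishes; by \<open>nz\<close> these do not affect the class.\<close>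
    let ?g = "\<lambda>i\<in>I. if f i = \<zero> then \<zero> else inv (f i)"
    have g: "?g \<in> seqs"
      using f by (auto simp: PiE_iff field_Units)
    have "ev (\<lambda>i. f i \<otimes> ?g i = \<one>)"
      using nz by (rule ev_mono) (use f in \<open>auto simp: PiE_iff field_Units\<close>)
    then have "X \<otimes>\<^bsub>K\<^esub> cls ?g = \<one>\<^bsub>K\<^esub>"
      using f g by (simp add: K_simps)
    then show "\<exists>Y\<in>carrier K. X \<otimes>\<^bsub>K\<^esub> Y = \<one>\<^bsub>K\<^esub>"
      using cls_closed[OF g] by blast
  qed
  moreover have "ordered_exp_field_axioms K"
  proof
    fix X assume "X \<in> carrier K"
    then show "\<not> lt K X X" "expo K X \<in> carrier K"
      by (auto elim!: carrier_cases del: equalityI simp: K_simps lt_irrefl expo_closed)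
  next
    fix X Y assume XY: "X \<in> carrier K" "Y \<in> carrier K"
    from XY obtain f g where fg: "f \<in> seqs" "X = cls f" "g \<in> seqs" "Y = cls g"
      by (metis carrier_cases)
    have "ev (\<lambda>i. lt F (f i) (g i) \<or> f i = g i \<or> lt F (g i) (f i))"
      using ev_True by (rule ev_mono) (use fg lt_total in \<open>auto simp: PiE_iff\<close>)
    then show "lt K X Y \<or> X = Y \<or> lt K Y X"
      using fg by (auto simp: K_simps dest!: ev_disj)
    assume pos: "lt K \<zero>\<^bsub>K\<^esub> X" "lt K \<zero>\<^bsub>K\<^esub> Y"
    then have "ev (\<lambda>i. lt F \<zero> (f i))" "ev (\<lambda>i. lt F \<zero> (g i))"
      using fg by (simp_all add: K_simps)
    then have "ev (\<lambda>i. lt F \<zero> (f i \<otimes> g i))"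
      by (rule ev_mono2) (use fg in \<open>auto simp: PiE_iff lt_mult\<close>)
    then show "lt K \<zero>\<^bsub>K\<^esub> (X \<otimes>\<^bsub>K\<^esub> Y)"
      using fg by (simp add: K_simps)
  next
    fix X Y Z assume XYZ: "X \<in> carrier K" "Y \<in> carrier K" "Z \<in> carrier K" and lt: "lt K X Y"
    from XYZ obtain f g h where
      fgh: "f \<in> seqs" "X = cls f" "g \<in> seqs" "Y = cls g" "h \<in> seqs" "Z = cls h"
      by (metis carrier_cases)
    have fg: "ev (\<lambda>i. lt F (f i) (g i))"
      using lt fgh by (simp add: K_simps)
    then have "ev (\<lambda>i. lt F (f i \<oplus> h i) (g i \<oplus> h i))"
      by (rule ev_mono) (use fgh in \<open>auto simp: PiE_iff lt_add\<close>)
    then show "lt K (X \<oplus>\<^bsub>K\<^esub> Z) (Y \<oplus>\<^bsub>K\<^esub> Z)"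
      using fgh by (simp add: K_simps)
    assume "lt K Y Z"
    then have "ev (\<lambda>i. lt F (g i) (h i))"
      using fgh by (simp add: K_simps)
    with fg have "ev (\<lambda>i. lt F (f i) (h i))"
      by (rule ev_mono2) (use fgh lt_trans in \<open>auto simp: PiE_iff\<close>)
    then show "lt K X Z"
      using fgh by (simp add: K_simps)
  qed
  ultimately show ?thesis
    by (simp add: ordered_exp_field_def)
qed

end

section \<open>Ordered field arithmetic\<close>

context ordered_exp_field
begin

lemma lt_asym: "\<lbrakk>x \<in> carrier F; y \<in> carrier F; lt F x y\<rbrakk> \<Longrightarrow> \<not> lt F y x"
  using lt_irrefl lt_trans by blast

lemma lt_iff_minus:
  assumes [simp]: "x \<in> carrier F" "y \<in> carrier F"
  shows "lt F x y \<longleftrightarrow> lt F \<zero> (y \<ominus> x)"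
proof
  assume "lt F x y"
  then have "lt F (x \<oplus> \<ominus> x) (y \<oplus> \<ominus> x)"
    by (simp add: lt_add)
  then show "lt F \<zero> (y \<ominus> x)"
    by (simp add: r_neg minus_eq)
next
  assume "lt F \<zero> (y \<ominus> x)"
  then have "lt F (\<zero> \<oplus> x) (y \<ominus> x \<oplus> x)"
    by (intro lt_add) auto
  moreover have "y \<ominus> x \<oplus> x = y"
    using assms by algebra
  ultimately show "lt F x y"
    by simp
qed

lemma pos_uminus: "x \<in> carrier F \<Longrightarrow> lt F \<zero> (\<ominus> x) \<longleftrightarrow> lt F x \<zero>"
  using lt_iff_minus[of x \<zero>] by (simp add: minus_eq)

lemma pos_add:
  assumes "x \<in> carrier F" "y \<in> carrier F" "lt F \<zero> x" "lt F \<zero> y"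
  shows "lt F \<zero> (x \<oplus> y)"
proof -
  have "lt F (\<zero> \<oplus> y) (x \<oplus> y)"
    using assms by (intro lt_add) auto
  then show ?thesis
    using assms lt_trans[of \<zero> y "x \<oplus> y"] by simp
qed

text \<open>If 1 were negative, -1 would be positive and so would its square, which is 1.\<close>

lemma pos_one: "lt F \<zero> \<one>"
proof (rule ccontr)
  assume no: "\<not> lt F \<zero> \<one>"
  then have "lt F \<one> \<zero>"
    using lt_total[of \<zero> \<one>] by auto
  then have "lt F \<zero> (\<ominus> \<one>)"
    by (simp add: pos_uminus)
  then have "lt F \<zero> (\<ominus> \<one> \<otimes> \<ominus> \<one>)"
    by (intro lt_mult) auto
  then show False
    using no by (simp add: l_minus)
qed

lemma obtain_inverse:
  assumes "x \<in> carrier F" "x \<noteq> \<zero>"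
  obtains y where "y \<in> carrier F" "x \<otimes> y = \<one>" "y \<otimes> x = \<one>"
  using assms by (metis Diff_iff Units_inv_closed Units_l_inv Units_r_inv field_Units singletonD)

text \<open>A negative \<open>y\<close> would make \<open>x\<close> times \<open>- y\<close>, that
  is -1, positive.\<close>

lemma pos_inverse:
  assumes [simp]: "x \<in> carrier F" "y \<in> carrier F" and "x \<otimes> y = \<one>" "lt F \<zero> x"
  shows "lt F \<zero> y"
proof (rule ccontr)
  assume no: "\<not> lt F \<zero> y"
  have "y \<noteq> \<zero>"
    using assms by auto
  then have "lt F \<zero> (\<ominus> y)"
    using lt_total[of \<zero> y] no by (auto simp: pos_uminus)
  then have "lt F \<zero> (x \<otimes> \<ominus> y)"
    using assms by (intro lt_mult) auto
  then have "lt F \<one> \<zero>"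
    using assms by (simp add: r_minus pos_uminus)
  then show False
    using pos_one lt_asym[of \<zero> \<one>] by simp
qed

definition unit_interval :: "'a set" where
  "unit_interval = {t \<in> carrier F. le F \<zero> t \<and> le F t \<one>}"

lemma unit_interval_closed: "t \<in> unit_interval \<Longrightarrow> t \<in> carrier F"
  by (simp add: unit_interval_def)

lemma zero_unit_interval: "\<zero> \<in> unit_interval"
  using pos_one by (simp add: unit_interval_def le_def)

lemma unit_interval_complement:
  assumes "t \<in> unit_interval" shows "\<one> \<ominus> t \<in> unit_interval"
proof -
  have t: "t \<in> carrier F"
    using assms by (rule unit_interval_closed)
  have *: "\<one> \<ominus> (\<one> \<ominus> t) = t"
    using t by algebra
  then show ?thesis
    using t assms lt_iff_minus[of t \<one>] lt_iff_minus[of "\<one> \<ominus> t" \<one>]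
    by (auto simp: unit_interval_def le_def minus_eq r_neg)
qed

text \<open>Multiplying \<open>t - 1 > 0\<close> by \<open>s > 0\<close> gives
  \<open>1 - s > 0\<close>. This brings parameters beyond 1 back into the range that betweenness can
  see.\<close>

lemma inverse_unit_interval:
  assumes "t \<in> carrier F" "lt F \<one> t" "s \<in> carrier F" "t \<otimes> s = \<one>"
  shows "s \<in> unit_interval"
proof -
  have "lt F \<zero> t"
    using assms lt_trans[of \<zero> \<one> t] pos_one by simp
  then have s: "lt F \<zero> s"
    using assms pos_inverse by blast
  moreover have "lt F \<zero> (t \<ominus> \<one>)"
    using assms lt_iff_minus[of \<one> t] by simp
  ultimately have "lt F \<zero> ((t \<ominus> \<one>) \<otimes> s)"
    using assms by (intro lt_mult) auto
  moreover have "(t \<ominus> \<one>) \<otimes> s = t \<otimes> s \<ominus> s"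
    using assms(1,3) by algebra
  ultimately show ?thesis
    using s assms lt_iff_minus[of s \<one>] by (simp add: unit_interval_def le_def)
qed

text \<open>1 + 1 is positive, hence invertible. The half locates the common midpoint of the
  diagonals of a parallelogram.\<close>

lemma obtain_half: obtains h where "h \<in> carrier F" "h \<oplus> h = \<one>"
proof -
  have "lt F \<zero> (\<one> \<oplus> \<one>)"
    using pos_one by (simp add: pos_add)
  then have "\<one> \<oplus> \<one> \<noteq> \<zero>"
    using lt_irrefl[of \<zero>] by auto
  then obtain h where h: "h \<in> carrier F" "(\<one> \<oplus> \<one>) \<otimes> h = \<one>"
    using obtain_inverse[of "\<one> \<oplus> \<one>"] by auto
  then have "h \<oplus> h = \<one>"
    by (simp add: l_distr)
  with h that show ?thesis
    by blast
qed

end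

section \<open>Collinearity in \<open>F\<^sup>d\<close>\<close>

locale coordinate_space = ordered_exp_field F for F :: "'a exp_field" (structure) +
  fixes d :: nat
  assumes dim_ge_2: "2 \<le> d"
begin

abbreviation "V \<equiv> pow_space d F"
abbreviation "bw \<equiv> Bw d F"

section \<open>Vector operations and parametrized lines\<close>

definition origin :: "nat \<Rightarrow> 'a" where
  "origin = (\<lambda>i\<in>{1..d}. \<zero>)"

definition basis :: "nat \<Rightarrow> nat \<Rightarrow> 'a" where
  "basis k = (\<lambda>i\<in>{1..d}. if i = k then \<one> else \<zero>)"

definition vadd :: "(nat \<Rightarrow> 'a) \<Rightarrow> (nat \<Rightarrow> 'a) \<Rightarrow> nat \<Rightarrow> 'a" (infixl "+\<^sub>v" 65) where
  "x +\<^sub>v y = (\<lambda>i\<in>{1..d}. x i \<oplus> y i)"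

definition smul :: "'a \<Rightarrow> (nat \<Rightarrow> 'a) \<Rightarrow> nat \<Rightarrow> 'a" (infixr "*\<^sub>v" 70) where
  "t *\<^sub>v x = (\<lambda>i\<in>{1..d}. t \<otimes> x i)"

text \<open>Any scalar is allowed as \<open>t\<close>, so for distinct \<open>a\<close> and
  \<open>b\<close> this runs through their whole line; parameters in \<open>unit_interval\<close>
  give the segment.\<close>

definition line_pt :: "(nat \<Rightarrow> 'a) \<Rightarrow> (nat \<Rightarrow> 'a) \<Rightarrow> 'a \<Rightarrow> nat \<Rightarrow> 'a" where
  "line_pt a b t = (\<lambda>i\<in>{1..d}. (\<one> \<ominus> t) \<otimes> a i \<oplus> t \<otimes> b i)"

lemma coord_closed: "\<lbrakk>x \<in> V; i \<in> {1..d}\<rbrakk> \<Longrightarrow> x i \<in> carrier F"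
  by (auto simp: pow_space_def)

lemma point_eqI: "\<lbrakk>x \<in> V; y \<in> V; \<And>i. i \<in> {1..d} \<Longrightarrow> x i = y i\<rbrakk> \<Longrightarrow> x = y"
  unfolding pow_space_def by (rule PiE_ext)

lemma origin_closed [simp]: "origin \<in> V"
  and basis_closed [simp]: "basis k \<in> V"
  and vadd_closed [simp]: "\<lbrakk>x \<in> V; y \<in> V\<rbrakk> \<Longrightarrow> x +\<^sub>v y \<in> V"
  and smul_closed [simp]: "\<lbrakk>t \<in> carrier F; x \<in> V\<rbrakk> \<Longrightarrow> t *\<^sub>v x \<in> V"
  and line_pt_closed [simp]: "\<lbrakk>x \<in> V; y \<in> V; t \<in> carrier F\<rbrakk> \<Longrightarrow> line_pt x y t \<in> V"
  by (auto simp: pow_space_def origin_def basis_def vadd_def smul_def line_pt_def PiE_iff)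

lemma coords:
  assumes "i \<in> {1..d}"
  shows "origin i = \<zero>" "basis k i = (if i = k then \<one> else \<zero>)"
    "(x +\<^sub>v y) i = x i \<oplus> y i" "(t *\<^sub>v x) i = t \<otimes> x i"
    "line_pt x y t i = (\<one> \<ominus> t) \<otimes> x i \<oplus> t \<otimes> y i"
  using assms by (simp_all add: origin_def basis_def vadd_def smul_def line_pt_def)

lemma vadd_comm: "\<lbrakk>x \<in> V; y \<in> V\<rbrakk> \<Longrightarrow> x +\<^sub>v y = y +\<^sub>v x"
  by (rule point_eqI) (simp_all add: coords coord_closed a_comm)

lemma vadd_assoc: "\<lbrakk>x \<in> V; y \<in> V; z \<in> V\<rbrakk> \<Longrightarrow> x +\<^sub>v y +\<^sub>v z = x +\<^sub>v (y +\<^sub>v z)"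
  by (rule point_eqI) (simp_all add: coords coord_closed a_assoc)

lemma vadd_origin [simp]: "x \<in> V \<Longrightarrow> origin +\<^sub>v x = x" "x \<in> V \<Longrightarrow> x +\<^sub>v origin = x"
  by (rule point_eqI, simp_all add: coords coord_closed)+

lemma vadd_right_cancel:
  assumes "x \<in> V" "y \<in> V" "z \<in> V" "x +\<^sub>v z = y +\<^sub>v z"
  shows "x = y"
proof (rule point_eqI)
  fix i assume i: "i \<in> {1..d}"
  show "x i = y i"
    using fun_cong[OF assms(4), of i] assms(1-3) i by (simp add: coords coord_closed)
qed (use assms in auto)

lemma smul_smul: "\<lbrakk>s \<in> carrier F; t \<in> carrier F; x \<in> V\<rbrakk> \<Longrightarrow> s *\<^sub>v t *\<^sub>v x = (s \<otimes> t) *\<^sub>v x"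
  by (rule point_eqI) (simp_all add: coords coord_closed m_assoc)

lemma smul_zero [simp]: "x \<in> V \<Longrightarrow> \<zero> *\<^sub>v x = origin"
  and smul_one [simp]: "x \<in> V \<Longrightarrow> \<one> *\<^sub>v x = x"
  and smul_origin [simp]: "t \<in> carrier F \<Longrightarrow> t *\<^sub>v origin = origin"
  by (rule point_eqI, simp_all add: coords coord_closed)+

lemma smul_add_left: "\<lbrakk>s \<in> carrier F; t \<in> carrier F; x \<in> V\<rbrakk> \<Longrightarrow> (s \<oplus> t) *\<^sub>v x = s *\<^sub>v x +\<^sub>v t *\<^sub>v x"
  by (rule point_eqI) (simp_all add: coords coord_closed l_distr)

lemma line_pt_ends [simp]: "\<lbrakk>a \<in> V; b \<in> V\<rbrakk> \<Longrightarrow> line_pt a b \<zero> = a"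
  "\<lbrakk>a \<in> V; b \<in> V\<rbrakk> \<Longrightarrow> line_pt a b \<one> = b"
  by (rule point_eqI, simp_all add: coords coord_closed minus_eq r_neg)+

lemma line_pt_origin: "\<lbrakk>x \<in> V; t \<in> carrier F\<rbrakk> \<Longrightarrow> line_pt origin x t = t *\<^sub>v x"
  by (rule point_eqI) (simp_all add: coords coord_closed)

lemma line_pt_swap:
  assumes [simp]: "a \<in> V" "b \<in> V" "t \<in> carrier F"
  shows "line_pt a b t = line_pt b a (\<one> \<ominus> t)"
proof (rule point_eqI)
  fix i assume i: "i \<in> {1..d}"
  then have "a i \<in> carrier F" "b i \<in> carrier F"
    by (auto intro: coord_closed)
  then show "line_pt a b t i = line_pt b a (\<one> \<ominus> t) i"
    unfolding coords[OF i] using assms by algebra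
qed auto

text \<open>Seen from \<open>a\<close>, the parameter acts as a scalar, so parameters multiply.
  Inverting one then exchanges \<open>b\<close> with another point of the line.\<close>

lemma line_pt_line_pt:
  assumes [simp]: "a \<in> V" "b \<in> V" "s \<in> carrier F" "t \<in> carrier F"
  shows "line_pt a (line_pt a b t) s = line_pt a b (s \<otimes> t)"
proof (rule point_eqI)
  fix i assume i: "i \<in> {1..d}"
  then have "a i \<in> carrier F" "b i \<in> carrier F"
    by (auto intro: coord_closed)
  then show "line_pt a (line_pt a b t) s i = line_pt a b (s \<otimes> t) i"
    unfolding coords[OF i] using assms by algebra
qed auto

section \<open>From betweenness to lines\<close>

lemma bw_iff:
  assumes "a \<in> V" "b \<in> V" "c \<in> V"
  shows "bw a b c \<longleftrightarrow> (\<exists>t\<in>unit_interval. b = line_pt a c t)"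
proof -
  have "(\<forall>i\<in>{1..d}. b i = (\<one> \<ominus> t) \<otimes> a i \<oplus> t \<otimes> c i) \<longleftrightarrow> b = line_pt a c t"
    if "t \<in> carrier F" for t
    using that assms by (auto intro!: point_eqI simp: coords)
  then show ?thesis
    by (auto simp: Bw_def unit_interval_def)
qed

lemma bw_imp_line_pt:
  "\<lbrakk>bw a b c; a \<in> V; b \<in> V; c \<in> V\<rbrakk> \<Longrightarrow> \<exists>t\<in>carrier F. b = line_pt a c t"
  using unit_interval_closed by (auto simp: bw_iff)

lemma bw_sym: "\<lbrakk>a \<in> V; b \<in> V; c \<in> V; bw a b c\<rbrakk> \<Longrightarrow> bw c b a"
  using unit_interval_complement unit_interval_closed line_pt_swap by (metis bw_iff)

lemma bw_left: "\<lbrakk>a \<in> V; b \<in> V\<rbrakk> \<Longrightarrow> bw a a b"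
  using zero_unit_interval line_pt_ends(1) by (metis bw_iff)

text \<open>Built from \<open>Bw\<close> alone, hence preserved by automorphisms. By
  \<open>bw_left\<close> a triple with a repeated point counts as collinear.\<close>

definition col :: "(nat \<Rightarrow> 'a) \<Rightarrow> (nat \<Rightarrow> 'a) \<Rightarrow> (nat \<Rightarrow> 'a) \<Rightarrow> bool" where
  "col a b c \<longleftrightarrow> bw a b c \<or> bw b c a \<or> bw c a b"

lemma col_swap: "\<lbrakk>a \<in> V; b \<in> V; c \<in> V; col a b c\<rbrakk> \<Longrightarrow> col b a c"
  using bw_sym[of a b c] bw_sym[of b c a] bw_sym[of c a b] by (auto simp: col_def)

lemma col_rotate: "col a b c \<Longrightarrow> col b c a"
  by (auto simp: col_def)

text \<open>From \<open>a\<close> to the far point, \<open>b\<close> has the parameter inverse to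
  \<open>t\<close>, which lies in \<open>unit_interval\<close>.\<close>

lemma bw_line_pt_beyond:
  assumes [simp]: "a \<in> V" "b \<in> V" "t \<in> carrier F" and "lt F \<one> t"
  shows "bw a b (line_pt a b t)"
proof -
  have "t \<noteq> \<zero>"
    using assms pos_one lt_asym[of \<zero> \<one>] by auto
  then obtain s where s: "s \<in> carrier F" "t \<otimes> s = \<one>" "s \<otimes> t = \<one>"
    using obtain_inverse[of t] by auto
  then have "s \<in> unit_interval"
    using assms inverse_unit_interval by blast
  moreover have "b = line_pt a (line_pt a b t) s"
    using s by (simp add: line_pt_line_pt)
  ultimately show ?thesis
    by (auto simp: bw_iff)
qed

text \<open>The position of \<open>t\<close> relative to 0 and 1 decides which of the three points
  is in the middle. A negative \<open>t\<close> becomes \<open>1 - t > 1\<close> when the ends are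
  exchanged.\<close>

lemma col_line_pt:
  assumes [simp]: "a \<in> V" "b \<in> V" "t \<in> carrier F"
  shows "col a b (line_pt a b t)"
proof -
  consider "lt F \<one> t" | "t \<in> unit_interval" | "lt F t \<zero>"
    using lt_total[of \<zero> t] lt_total[of \<one> t] by (auto simp: unit_interval_def le_def)
  then show ?thesis
  proof cases
    case 1
    then show ?thesis
      by (simp add: col_def bw_line_pt_beyond)
  next
    case 2
    then have "bw a (line_pt a b t) b"
      by (auto simp: bw_iff)
    then have "bw b (line_pt a b t) a"
      by (simp add: bw_sym)
    then show ?thesis
      by (simp add: col_def)
  next
    case 3
    have "\<one> \<ominus> t \<ominus> \<one> = \<zero> \<ominus> t"
      using assms by algebra
    with 3 have "lt F \<one> (\<one> \<ominus> t)"
      using lt_iff_minus[of \<one> "\<one> \<ominus> t"] lt_iff_minus[of t \<zero>] by simp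
    then have "bw b a (line_pt a b t)"
      using bw_line_pt_beyond[of b a "\<one> \<ominus> t"] by (simp add: line_pt_swap[of a b])
    then show ?thesis
      by (simp add: col_def bw_sym)
  qed
qed

lemma line_pt_invert:
  assumes [simp]: "a \<in> V" "c \<in> V" "t \<in> carrier F" and "line_pt a c t \<noteq> a"
  obtains s where "s \<in> carrier F" "c = line_pt a (line_pt a c t) s"
proof -
  have "t \<noteq> \<zero>"
    using assms by auto
  then obtain s where s: "s \<in> carrier F" "s \<otimes> t = \<one>"
    using obtain_inverse[of t] by auto
  with that show ?thesis
    by (simp add: line_pt_line_pt)
qed

text \<open>If \<open>c\<close> is in the middle, its parameter is given directly. If
  \<open>a\<close> or \<open>b\<close> is, that point is parametrized by means of \<open>c\<close>,
  and \<open>a \<noteq> b\<close> makes the parameter invertible.\<close>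

lemma col_iff_line_pt:
  assumes [simp]: "a \<in> V" "b \<in> V" "c \<in> V" and "a \<noteq> b"
  shows "col a b c \<longleftrightarrow> (\<exists>t\<in>carrier F. c = line_pt a b t)"
proof
  assume "col a b c"
  then consider "bw a b c" | "bw b c a" | "bw b a c"
    using bw_sym[of c a b] by (auto simp: col_def)
  then show "\<exists>t\<in>carrier F. c = line_pt a b t"
  proof cases
    case 1
    then obtain t where "t \<in> carrier F" "b = line_pt a c t"
      using bw_imp_line_pt assms(1-3) by blast
    then show ?thesis
      using \<open>a \<noteq> b\<close> line_pt_invert[of a c t] by auto
  next
    case 2
    then obtain t where "t \<in> carrier F" "c = line_pt b a t"
      using bw_imp_line_pt assms(1-3) by blast
    then show ?thesis
      by (auto simp: line_pt_swap[of b a])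
  next
    case 3
    then obtain t where "t \<in> carrier F" "a = line_pt b c t"
      using bw_imp_line_pt assms(1-3) by blast
    then obtain s where "s \<in> carrier F" "c = line_pt b a s"
      using \<open>a \<noteq> b\<close> line_pt_invert[of b c t] by auto
    then show ?thesis
      by (auto simp: line_pt_swap[of b a])
  qed
qed (auto simp: col_line_pt)

lemma col_origin_iff:
  "\<lbrakk>x \<in> V; y \<in> V; x \<noteq> origin\<rbrakk> \<Longrightarrow> col origin x y \<longleftrightarrow> (\<exists>t\<in>carrier F. y = t *\<^sub>v x)"
  by (auto simp: col_iff_line_pt line_pt_origin)

lemma col_origin_smul: "\<lbrakk>x \<in> V; t \<in> carrier F\<rbrakk> \<Longrightarrow> col origin x (t *\<^sub>v x)"
  using col_line_pt[of origin x t] by (simp add: line_pt_origin)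

lemma col_origin_sym: "\<lbrakk>x \<in> V; y \<in> V; col origin x y\<rbrakk> \<Longrightarrow> col origin y x"
  by (rule col_swap[OF _ _ _ col_rotate[OF col_rotate]]) simp_all

text \<open>Non-collinearity with the origin plays the role of linear independence; zero vectors are
  excluded because repeated points are collinear.\<close>

lemma not_col_origin:
  assumes "x \<in> V" "y \<in> V" "\<not> col origin x y"
  shows "x \<noteq> origin" "y \<noteq> origin" "t \<in> carrier F \<Longrightarrow> y \<noteq> t *\<^sub>v x"
  using assms bw_left[of origin] col_origin_smul col_origin_sym[of y x] by (auto simp: col_def)

section \<open>Addition from collinearity\<close>

text \<open>The diagonals of the quadrilateral \<open>0, x, z, y\<close> meet (so it is planar) and opposite sides
  do not.\<close>

definition parallelogram :: "(nat \<Rightarrow> 'a) \<Rightarrow> (nat \<Rightarrow> 'a) \<Rightarrow> (nat \<Rightarrow> 'a) \<Rightarrow> bool" where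
  "parallelogram x y z \<longleftrightarrow>
     (\<exists>m\<in>V. col x y m \<and> col origin m z) \<and>
     (\<forall>p\<in>V. \<not> (col origin x p \<and> col y z p)) \<and>
     (\<forall>p\<in>V. \<not> (col origin y p \<and> col x z p))"

text \<open>A common point would satisfy \<open>s x = y + t x\<close>, so that
  \<open>y = (s - t) x\<close>, against independence.\<close>

lemma parallel_sides_disjoint:
  assumes xy [simp]: "x \<in> V" "y \<in> V" and indep: "\<not> col origin x y"
    and p: "p \<in> V" "col origin x p" "col y (x +\<^sub>v y) p"
  shows False
proof -
  have x0: "x \<noteq> origin"
    using not_col_origin[OF xy indep] by blast
  then obtain s where s: "s \<in> carrier F" "p = s *\<^sub>v x"
    using p by (auto simp: col_origin_iff)
  have "y \<noteq> x +\<^sub>v y"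
    using x0 vadd_right_cancel[of origin x y] by auto
  then obtain t where t: "t \<in> carrier F" "p = line_pt y (x +\<^sub>v y) t"
    using p by (auto simp: col_iff_line_pt)
  have "y = (s \<ominus> t) *\<^sub>v x"
  proof (rule point_eqI)
    fix i assume i: "i \<in> {1..d}"
    have c: "x i \<in> carrier F" "y i \<in> carrier F"
      using i by (auto intro: coord_closed)
    have "y i = ((\<one> \<ominus> t) \<otimes> y i \<oplus> t \<otimes> (x i \<oplus> y i)) \<ominus> t \<otimes> x i"
      using c t(1) by algebra
    also have "\<dots> = s \<otimes> x i \<ominus> t \<otimes> x i"
      using fun_cong[OF trans[OF s(2)[symmetric] t(2)], of i] i by (simp add: coords)
    also have "\<dots> = (s \<ominus> t) \<otimes> x i"
      using c s(1) t(1) by algebra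
    finally show "y i = ((s \<ominus> t) *\<^sub>v x) i"
      using i by (simp add: coords)
  qed (use s t in auto)
  then show False
    using not_col_origin(3)[OF xy indep, of "s \<ominus> t"] s t by simp
qed

text \<open>On the line from \<open>y\<close> to \<open>a x + b y\<close> the coefficient of
  \<open>y\<close> at parameter \<open>t\<close> is \<open>1 - t (1 - b)\<close>. It vanishes at the
  inverse of \<open>1 - b\<close>, and that point lies on the line of \<open>x\<close>.\<close>

lemma sides_meet:
  assumes xy [simp]: "x \<in> V" "y \<in> V" "a \<in> carrier F" "b \<in> carrier F" and "b \<noteq> \<one>"
  obtains p where "p \<in> V" "col origin x p" "col y (a *\<^sub>v x +\<^sub>v b *\<^sub>v y) p"
proof -
  have "b = \<one> \<ominus> (\<one> \<ominus> b)"
    using \<open>b \<in> carrier F\<close> by algebra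
  then have "\<one> \<ominus> b \<noteq> \<zero>"
    using \<open>b \<noteq> \<one>\<close> by (auto simp: minus_eq)
  then obtain t where t [simp]: "t \<in> carrier F" and "t \<otimes> (\<one> \<ominus> b) = \<one>"
    using obtain_inverse[of "\<one> \<ominus> b"] by auto
  have "line_pt y (a *\<^sub>v x +\<^sub>v b *\<^sub>v y) t = (t \<otimes> a) *\<^sub>v x"
  proof (rule point_eqI)
    fix i assume i: "i \<in> {1..d}"
    have c: "x i \<in> carrier F" "y i \<in> carrier F"
      using i by (auto intro: coord_closed)
    have "(\<one> \<ominus> t) \<otimes> y i \<oplus> t \<otimes> (a \<otimes> x i \<oplus> b \<otimes> y i)
      = (t \<otimes> a) \<otimes> x i \<oplus> (\<one> \<ominus> t \<otimes> (\<one> \<ominus> b)) \<otimes> y i"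
      using c assms(3,4) t by algebra
    also have "\<dots> = (t \<otimes> a) \<otimes> x i"
      using c \<open>t \<otimes> (\<one> \<ominus> b) = \<one>\<close> by (simp add: minus_eq r_neg)
    finally show "line_pt y (a *\<^sub>v x +\<^sub>v b *\<^sub>v y) t i = ((t \<otimes> a) *\<^sub>v x) i"
      using i by (simp add: coords)
  qed auto
  then have "col y (a *\<^sub>v x +\<^sub>v b *\<^sub>v y) ((t \<otimes> a) *\<^sub>v x)"
    using col_line_pt[of y "a *\<^sub>v x +\<^sub>v b *\<^sub>v y" t] by simp
  then show ?thesis
    using that[of "(t \<otimes> a) *\<^sub>v x"] col_origin_smul by simp
qed

text \<open>For \<open>x + y\<close> the diagonals share their midpoint, and exchanging
  \<open>x\<close> and \<open>y\<close> settles the second pair of sides. Conversely, the point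
  \<open>m\<close> puts \<open>z\<close> into the form \<open>a x + b y\<close>; a coefficient other
  than 1 would make a pair of opposite sides meet by \<open>sides_meet\<close>.\<close>

lemma parallelogram_iff:
  assumes xyz [simp]: "x \<in> V" "y \<in> V" "z \<in> V" and indep: "\<not> col origin x y"
  shows "parallelogram x y z \<longleftrightarrow> z = x +\<^sub>v y"
proof
  assume "z = x +\<^sub>v y"
  obtain h where h: "h \<in> carrier F" "h \<oplus> h = \<one>"
    by (rule obtain_half)
  have "h \<oplus> h \<ominus> h = h"
    using h(1) by algebra
  then have "\<one> \<ominus> h = h"
    using h by simp
  then have mid: "line_pt x y h = line_pt origin z h"
    unfolding \<open>z = _\<close>
    by (intro point_eqI) (use h in \<open>simp_all add: coords coord_closed r_distr\<close>)
  have "col x y (line_pt x y h)"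
    using h by (simp add: col_line_pt)
  moreover have "col origin (line_pt x y h) z"
  proof (rule col_origin_sym)
    show "col origin z (line_pt x y h)"
      unfolding mid using h by (simp add: col_line_pt)
  qed (use h in auto)
  moreover have "\<not> (col origin x p \<and> col y z p)" "\<not> (col origin y p \<and> col x z p)"
    if "p \<in> V" for p
    using that parallel_sides_disjoint[of x y p] parallel_sides_disjoint[of y x p] indep
      col_origin_sym[of y x] \<open>z = x +\<^sub>v y\<close> vadd_comm[of x y] by auto
  ultimately show "parallelogram x y z"
    using h by (auto simp: parallelogram_def intro: bexI[of _ "line_pt x y h"])
next
  assume par: "parallelogram x y z"
  then obtain m where m: "m \<in> V" "col x y m" "col origin m z"
    by (auto simp: parallelogram_def)
  have "m \<noteq> origin"
    using m indep col_rotate xyz by blast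
  then obtain r where r: "r \<in> carrier F" "z = r *\<^sub>v m"
    using m by (auto simp: col_origin_iff)
  have "x \<noteq> y"
    using indep col_origin_smul[of x \<one>] by auto
  then obtain s where s: "s \<in> carrier F" "m = line_pt x y s"
    using m by (auto simp: col_iff_line_pt)
  define a b where "a = r \<otimes> (\<one> \<ominus> s)" and "b = r \<otimes> s"
  have ab [simp]: "a \<in> carrier F" "b \<in> carrier F"
    using r s by (auto simp: a_def b_def)
  have z: "z = a *\<^sub>v x +\<^sub>v b *\<^sub>v y"
  proof (rule point_eqI)
    fix i assume i: "i \<in> {1..d}"
    then have "x i \<in> carrier F" "y i \<in> carrier F"
      by (auto intro: coord_closed)
    then show "z i = (a *\<^sub>v x +\<^sub>v b *\<^sub>v y) i"
      unfolding r(2) s(2) coords[OF i] a_def b_def using r(1) s(1) by algebra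
  qed auto
  have "b = \<one>"
    using sides_meet[of x y a b] par unfolding z parallelogram_def by (metis ab xyz(1,2))
  moreover have "a = \<one>"
    using sides_meet[of y x b a] par vadd_comm[of "a *\<^sub>v x" "b *\<^sub>v y"]
    unfolding z parallelogram_def by (metis ab xyz(1,2) smul_closed)
  ultimately show "z = x +\<^sub>v y"
    by (simp add: z)
qed

end

section \<open>Automorphisms of the geometry\<close>

lemma (in coordinate_space) identity_affine:
  "affine_map d F (mat_one d F) origin = (\<lambda>x\<in>V. x)"
proof -
  have "(\<Oplus>j\<in>{1..d}. mat_one d F i j \<otimes> x j) \<oplus> origin i = x i"
    if x: "x \<in> V" and i: "i \<in> {1..d}" for x i
  proof -
    have "(\<Oplus>j\<in>{1..d}. mat_one d F i j \<otimes> x j) = (\<Oplus>j\<in>{1..d}. if i = j then x j else \<zero>)"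
      using x i by (intro finsum_cong') (auto simp: mat_one_def coord_closed)
    also have "\<dots> = x i"
      using x i by (intro finsum_singleton) (auto simp: coord_closed)
    finally show ?thesis
      using x i by (simp add: coords coord_closed)
  qed
  then show ?thesis
    unfolding affine_map_def
    by (intro restrict_ext) (auto intro!: point_eqI simp: pow_space_def coord_closed)
qed

lemma (in coordinate_space) mat_one_GL: "mat_one d F \<in> GL d F"
proof -
  have "(\<Oplus>k\<in>{1..d}. mat_one d F i k \<otimes> mat_one d F k j) = mat_one d F i j"
    if ij: "i \<in> {1..d}" "j \<in> {1..d}" for i j
  proof -
    have "(\<Oplus>k\<in>{1..d}. mat_one d F i k \<otimes> mat_one d F k j)
      = (\<Oplus>k\<in>{1..d}. if i = k then mat_one d F k j else \<zero>)"
      using ij by (intro finsum_cong') (auto simp: mat_one_def)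
    also have "\<dots> = mat_one d F i j"
      using ij by (intro finsum_singleton) (auto simp: mat_one_def)
    finally show ?thesis .
  qed
  then have "mat_mult d F (mat_one d F) (mat_one d F) = (\<lambda>i\<in>{1..d}. \<lambda>j\<in>{1..d}. mat_one d F i j)"
    unfolding mat_mult_def by (intro restrict_ext) auto
  also have "\<dots> = mat_one d F"
    by (auto simp: mat_one_def fun_eq_iff)
  finally have "mat_mult d F (mat_one d F) (mat_one d F) = mat_one d F" .
  moreover have "mat_one d F \<in> mats d F"
    by (auto simp: mats_def mat_one_def)
  ultimately show ?thesis
    by (auto simp: GL_def)
qed

lemma identity_Aut: "(\<lambda>x\<in>universe G. x) \<in> Aut G"
proof -
  have "map (\<lambda>x\<in>universe G. x) xs = xs" if "xs \<in> lists (universe G)" for xs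
    using that by (intro map_idI) auto
  then show ?thesis
    by (simp add: Aut_def id_Bij)
qed

lemma universe_G_exp [simp]: "universe (G_exp d F) = pow_space d F"
  by (simp add: G_exp_def)

lemma (in coordinate_space) identity_AffAut: "(\<lambda>x\<in>V. x) \<in> AffAut d F (G_exp d F)"
  unfolding AffAut_def
proof (intro CollectI conjI bexI)
  show "(\<lambda>x\<in>V. x) \<in> Aut (G_exp d F)"
    using identity_Aut[of "G_exp d F"] by (simp only: universe_G_exp)
qed (fact identity_affine[symmetric] mat_one_GL origin_closed)+

locale geometry_automorphism = coordinate_space F d for F :: "'a exp_field" (structure) and d +
  fixes \<alpha> :: "(nat \<Rightarrow> 'a) \<Rightarrow> nat \<Rightarrow> 'a"
  assumes aut: "\<alpha> \<in> Aut (G_exp d F)"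
begin

section \<open>What an automorphism preserves\<close>

lemma alpha_Bij: "\<alpha> \<in> Bij V"
  using aut unfolding Aut_def universe_G_exp by (elim CollectE conjE)

lemma alpha_bij: "bij_betw \<alpha> V V"
  using alpha_Bij unfolding Bij_def by (elim IntE CollectE)

lemma alpha_closed [simp]: "x \<in> V \<Longrightarrow> \<alpha> x \<in> V"
  by (rule bij_betw_apply[OF alpha_bij])

lemma alpha_inj: "\<lbrakk>x \<in> V; y \<in> V; \<alpha> x = \<alpha> y\<rbrakk> \<Longrightarrow> x = y"
  by (rule inj_onD[OF bij_betw_imp_inj_on[OF alpha_bij]])

lemma alpha_surj: assumes "y \<in> V" obtains x where "x \<in> V" "y = \<alpha> x"
proof -
  have "y \<in> \<alpha> ` V"
    using assms bij_betw_imp_surj_on[OF alpha_bij] by simp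
  then show ?thesis
    using that by (elim imageE)
qed

lemma alpha_rel:
  assumes "s \<in> symbols (G_exp d F)" and "xs \<in> lists V"
  shows "xs \<in> rel (G_exp d F) s \<longleftrightarrow> map \<alpha> xs \<in> rel (G_exp d F) s"
proof -
  have "\<forall>s\<in>symbols (G_exp d F). \<forall>xs\<in>lists V.
      xs \<in> rel (G_exp d F) s \<longleftrightarrow> map \<alpha> xs \<in> rel (G_exp d F) s"
    using aut unfolding Aut_def universe_G_exp by (elim CollectE conjE)
  from bspec[OF bspec[OF this assms(1)] assms(2)] show ?thesis .
qed

lemma alpha_bw: "\<lbrakk>a \<in> V; b \<in> V; c \<in> V\<rbrakk> \<Longrightarrow> bw a b c \<longleftrightarrow> bw (\<alpha> a) (\<alpha> b) (\<alpha> c)"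
  using alpha_rel[of BwSym "[a, b, c]"] by (simp add: G_exp_def)

lemma alpha_col: "\<lbrakk>a \<in> V; b \<in> V; c \<in> V\<rbrakk> \<Longrightarrow> col a b c \<longleftrightarrow> col (\<alpha> a) (\<alpha> b) (\<alpha> c)"
  by (simp add: col_def alpha_bw[symmetric])

lemma alpha_origin [simp]: "\<alpha> origin = origin"
proof (rule point_eqI)
  fix i assume "i \<in> {1..d}"
  moreover have "Origin d F (\<alpha> origin)"
    using alpha_rel[of OSym "[origin]"] by (simp add: G_exp_def Origin_def coords)
  ultimately show "\<alpha> origin i = origin i"
    by (simp add: Origin_def coords)
qed auto

lemma alpha_basis: assumes "k \<in> {1..d}" shows "\<alpha> (basis k) = basis k"
proof (rule point_eqI)
  fix i assume "i \<in> {1..d}"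
  moreover have "Basis_pt d F k (\<alpha> (basis k))"
    using alpha_rel[of "ESym k" "[basis k]"] assms by (simp add: G_exp_def Basis_pt_def coords)
  ultimately show "\<alpha> (basis k) i = basis k i"
    by (simp add: Basis_pt_def coords)
qed auto

lemma alpha_Gamma: "\<lbrakk>p \<in> V; q \<in> V; Gamma_exp d F p q\<rbrakk> \<Longrightarrow> Gamma_exp d F (\<alpha> p) (\<alpha> q)"
  using alpha_rel[of GammaSym "[p, q]"] by (simp add: G_exp_def)

section \<open>Additivity and lines through the origin\<close>

lemma alpha_parallelogram:
  assumes [simp]: "x \<in> V" "y \<in> V" "z \<in> V" and "parallelogram x y z"
  shows "parallelogram (\<alpha> x) (\<alpha> y) (\<alpha> z)"
proof -
  obtain m where "m \<in> V" "col x y m" "col origin m z"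
    using assms by (auto simp: parallelogram_def)
  then have "\<alpha> m \<in> V" "col (\<alpha> x) (\<alpha> y) (\<alpha> m)" "col origin (\<alpha> m) (\<alpha> z)"
    using alpha_col[of x y m] alpha_col[of origin m z] by auto
  moreover have "\<not> (col origin (\<alpha> x) q \<and> col (\<alpha> y) (\<alpha> z) q)"
    "\<not> (col origin (\<alpha> y) q \<and> col (\<alpha> x) (\<alpha> z) q)" if "q \<in> V" for q
  proof -
    \<comment> \<open>Disjointness of sides speaks of all points, so surjectivity is needed to pull
      \<open>q\<close> back.\<close>
    obtain p where p: "p \<in> V" "q = \<alpha> p"
      using alpha_surj \<open>q \<in> V\<close> by blast
    show "\<not> (col origin (\<alpha> x) q \<and> col (\<alpha> y) (\<alpha> z) q)"
      "\<not> (col origin (\<alpha> y) q \<and> col (\<alpha> x) (\<alpha> z) q)"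
      using p assms alpha_col[of origin x p] alpha_col[of y z p]
        alpha_col[of origin y p] alpha_col[of x z p]
      by (auto simp: parallelogram_def)
  qed
  ultimately show ?thesis
    by (auto simp: parallelogram_def)
qed

lemma alpha_add_indep:
  assumes "x \<in> V" "y \<in> V" "\<not> col origin x y"
  shows "\<alpha> (x +\<^sub>v y) = \<alpha> x +\<^sub>v \<alpha> y"
proof -
  have "parallelogram (\<alpha> x) (\<alpha> y) (\<alpha> (x +\<^sub>v y))"
    using assms by (intro alpha_parallelogram) (auto simp: parallelogram_iff)
  moreover have "\<not> col origin (\<alpha> x) (\<alpha> y)"
    using assms alpha_col[of origin x y] by simp
  ultimately show ?thesis
    using assms by (simp add: parallelogram_iff)
qed

text \<open>If the first two basis vectors were both multiples of \<open>x\<close>, then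
  \<open>t\<close> and the first coordinate of \<open>x\<close> would be nonzero with product zero.
  Both vectors exist because \<open>2 \<le> d\<close>.\<close>

lemma exists_not_col:
  assumes x: "x \<in> V" "x \<noteq> origin"
  obtains z where "z \<in> V" "\<not> col origin x z"
proof -
  have ix: "1 \<in> {1..d}" "2 \<in> {1..d}"
    using dim_ge_2 by auto
  have "\<not> col origin x (basis 1) \<or> \<not> col origin x (basis 2)"
  proof (rule ccontr)
    assume "\<not> ?thesis"
    then obtain s t where st: "s \<in> carrier F" "basis 1 = s *\<^sub>v x" "t \<in> carrier F" "basis 2 = t *\<^sub>v x"
      using x by (auto simp: col_origin_iff)
    have "s \<otimes> x 1 = \<one>" "t \<otimes> x 1 = \<zero>" "t \<otimes> x 2 = \<one>"
      using fun_cong[OF st(2), of 1] fun_cong[OF st(4), of 1] fun_cong[OF st(4), of 2] ix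
      by (simp_all add: coords)
    then show False
      using integral_iff[of t "x 1"] coord_closed[OF x(1)] st ix by auto
  qed
  then show ?thesis
    using that[OF basis_closed] by (elim disjE)
qed

text \<open>For collinear nonzero summands an independent \<open>z\<close> is added: the image of
  \<open>x + y + z\<close> is computed by splitting off \<open>z\<close> and by splitting off
  \<open>x\<close>, after which \<open>\<alpha> z\<close> cancels.\<close>

lemma alpha_add:
  assumes [simp]: "x \<in> V" "y \<in> V"
  shows "\<alpha> (x +\<^sub>v y) = \<alpha> x +\<^sub>v \<alpha> y"
proof (cases "x = origin \<or> y = origin \<or> \<not> col origin x y")
  case True
  then show ?thesis
    using alpha_add_indep by auto
next
  case False
  then obtain t where t: "t \<in> carrier F" "y = t *\<^sub>v x"
    by (auto simp: col_origin_iff)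
  obtain z where z [simp]: "z \<in> V" and xz: "\<not> col origin x z"
    using exists_not_col[of x] False by auto
  have smul_indep: "\<not> col origin (s *\<^sub>v x) z" if "s \<in> carrier F" "s *\<^sub>v x \<noteq> origin" for s
    using that not_col_origin(3)[OF _ _ xz] by (auto simp: col_origin_iff smul_smul)
  have yz: "\<not> col origin y z"
    using smul_indep[of t] t False by simp
  have xyz: "\<not> col origin x (y +\<^sub>v z)"
  proof
    assume "col origin x (y +\<^sub>v z)"
    then obtain s where s: "s \<in> carrier F" "y +\<^sub>v z = s *\<^sub>v x"
      using False by (auto simp: col_origin_iff)
    have "z +\<^sub>v y = (s \<ominus> t) *\<^sub>v x +\<^sub>v t *\<^sub>v x"
    proof -
      have "s \<ominus> t \<oplus> t = s"
        using s(1) t(1) by algebra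
      then show ?thesis
        using s t by (simp add: smul_add_left[symmetric] vadd_comm[of z])
    qed
    then have "z = (s \<ominus> t) *\<^sub>v x"
      using vadd_right_cancel[of z "(s \<ominus> t) *\<^sub>v x" y] s t by simp
    then show False
      using not_col_origin(3)[OF _ _ xz, of "s \<ominus> t"] s t by simp
  qed
  have xy: "x +\<^sub>v y = (\<one> \<oplus> t) *\<^sub>v x"
    using t by (simp add: smul_add_left)
  have "\<alpha> (x +\<^sub>v y) +\<^sub>v \<alpha> z = \<alpha> ((x +\<^sub>v y) +\<^sub>v z)"
  \<comment> \<open>Opposite vectors have sum zero, which is collinear with everything, so
    \<open>alpha_add_indep\<close> would not apply to it.\<close>
  proof (cases "x +\<^sub>v y = origin")
    case True
    then show ?thesis
      by simp
  next
    case False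
    then have "\<not> col origin (x +\<^sub>v y) z"
      using smul_indep[of "\<one> \<oplus> t"] t(1) unfolding xy by simp
    then show ?thesis
      by (simp add: alpha_add_indep)
  qed
  also have "\<dots> = \<alpha> x +\<^sub>v \<alpha> y +\<^sub>v \<alpha> z"
    using xyz yz by (simp add: vadd_assoc alpha_add_indep)
  finally show ?thesis
    using vadd_right_cancel[of "\<alpha> (x +\<^sub>v y)" "\<alpha> x +\<^sub>v \<alpha> y" "\<alpha> z"] by simp
qed

text \<open>Collinearity with the origin is preserved. So far the scalar \<open>s\<close> may depend
  on \<open>x\<close> as well as on \<open>t\<close>.\<close>

lemma alpha_smul:
  assumes "x \<in> V" "t \<in> carrier F"
  obtains s where "s \<in> carrier F" "\<alpha> (t *\<^sub>v x) = s *\<^sub>v \<alpha> x"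
proof (cases "x = origin")
  case True
  then show ?thesis
    using assms that[of t] by simp
next
  case False
  then have "\<alpha> x \<noteq> origin"
    using assms alpha_inj[of x origin] by auto
  moreover have "col origin (\<alpha> x) (\<alpha> (t *\<^sub>v x))"
    using assms alpha_col[of origin x "t *\<^sub>v x"] by (simp add: col_origin_smul)
  ultimately show ?thesis
    using assms that by (auto simp: col_origin_iff)
qed

section \<open>The scalar map read off on the first axis, and the coordinates of
  \<open>\<alpha>\<close>\<close>

definition sigma :: "'a \<Rightarrow> 'a" where
  "sigma = (\<lambda>t\<in>carrier F. \<alpha> (t *\<^sub>v basis 1) 1)"

lemma one_mem: "1 \<in> {1..d}" and two_mem: "2 \<in> {1..d}"
  using dim_ge_2 by auto

lemma sigma_closed [simp]: "t \<in> carrier F \<Longrightarrow> sigma t \<in> carrier F"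
  using coord_closed[OF _ one_mem, of "\<alpha> (t *\<^sub>v basis 1)"] by (simp add: sigma_def)

text \<open>By additivity \<open>\<alpha>\<close> fixes the sum of \<open>basis 1\<close> and
  \<open>basis k\<close>, so the image of its \<open>t\<close>-fold is an \<open>r\<close>-fold of
  it. Comparing coordinates 1 and \<open>k\<close> shows that both axes carry the scalar
  \<open>r\<close>.\<close>

lemma alpha_smul_basis:
  assumes k: "k \<in> {1..d}" and t: "t \<in> carrier F"
  shows "\<alpha> (t *\<^sub>v basis k) = sigma t *\<^sub>v basis k"
proof -
  obtain s where s: "s \<in> carrier F" "\<alpha> (t *\<^sub>v basis k) = s *\<^sub>v basis k"
    using alpha_smul[of "basis k" t] alpha_basis[OF k] t by auto
  obtain s1 where s1: "s1 \<in> carrier F" "\<alpha> (t *\<^sub>v basis 1) = s1 *\<^sub>v basis 1"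
    using alpha_smul[of "basis 1" t] alpha_basis[OF one_mem] t by auto
  then have "sigma t = s1"
    using t one_mem by (simp add: sigma_def coords)
  moreover have "s1 = s"
  proof (cases "k = 1")
    case True
    have "(s1 *\<^sub>v basis 1) 1 = (s *\<^sub>v basis 1) 1"
      using s s1 True by simp
    then show ?thesis
      using s s1 one_mem by (simp add: coords)
  next
    case False
    have "t *\<^sub>v (basis 1 +\<^sub>v basis k) = t *\<^sub>v basis 1 +\<^sub>v t *\<^sub>v basis k"
      using t by (intro point_eqI) (simp_all add: coords r_distr)
    moreover obtain r where r: "r \<in> carrier F"
      "\<alpha> (t *\<^sub>v (basis 1 +\<^sub>v basis k)) = r *\<^sub>v \<alpha> (basis 1 +\<^sub>v basis k)"
      using alpha_smul[of "basis 1 +\<^sub>v basis k" t] t by auto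
    ultimately have "r *\<^sub>v (basis 1 +\<^sub>v basis k) = s1 *\<^sub>v basis 1 +\<^sub>v s *\<^sub>v basis k"
      using t s s1 k one_mem by (simp add: alpha_add alpha_basis)
    then have eq: "(r *\<^sub>v (basis 1 +\<^sub>v basis k)) i = (s1 *\<^sub>v basis 1 +\<^sub>v s *\<^sub>v basis k) i" for i
      by simp
    have "r = s1" "r = s"
      using eq[of 1] eq[of k] False k one_mem r s s1 by (simp_all add: coords)
    then show ?thesis
      by simp
  qed
  ultimately show ?thesis
    using s by simp
qed

lemma alpha_coords:
  assumes x: "x \<in> V" and i: "i \<in> {1..d}"
  shows "\<alpha> x i = sigma (x i)"
proof -
  \<comment> \<open>Truncation to the first \<open>n\<close> coordinates carries additivity through
    the basis expansion by induction. Indices start at 1, so stage 0 is the origin; stage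
    \<open>d\<close> is the whole point.\<close>
  define trunc :: "(nat \<Rightarrow> 'a) \<Rightarrow> nat \<Rightarrow> nat \<Rightarrow> 'a"
    where "trunc y n = (\<lambda>i\<in>{1..d}. if i \<le> n then y i else \<zero>)" for y n
  have trunc_closed: "trunc y n \<in> V" if "\<And>i. i \<in> {1..d} \<Longrightarrow> y i \<in> carrier F" for y n
    using that by (auto simp: trunc_def pow_space_def)
  have trunc_0: "trunc y 0 = origin" for y
    by (auto simp: trunc_def origin_def)
  have trunc_Suc: "trunc y (Suc n) = trunc y n +\<^sub>v y (Suc n) *\<^sub>v basis (Suc n)"
    if y: "\<And>i. i \<in> {1..d} \<Longrightarrow> y i \<in> carrier F" and "Suc n \<le> d" for y n
  proof (rule point_eqI)
    fix i assume i: "i \<in> {1..d}"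
    have "y (Suc n) \<in> carrier F"
      using y \<open>Suc n \<le> d\<close> by simp
    then show "trunc y (Suc n) i = (trunc y n +\<^sub>v y (Suc n) *\<^sub>v basis (Suc n)) i"
      using i y[of i] by (auto simp: coords trunc_def le_Suc_eq)
  qed (use that trunc_closed in auto)
  have xc: "x j \<in> carrier F" if "j \<in> {1..d}" for j
    using coord_closed[OF x that] .
  have tx: "trunc x n \<in> V" for n
    by (rule trunc_closed) (rule xc)
  have "\<alpha> (trunc x n) = trunc (\<lambda>i. sigma (x i)) n" if "n \<le> d" for n
    using that
  proof (induction n)
    case 0
    then show ?case
      by (simp add: trunc_0)
  next
    case (Suc n)
    have n: "Suc n \<in> {1..d}"
      using Suc.prems by simp
    have "\<alpha> (trunc x (Suc n)) = \<alpha> (trunc x n) +\<^sub>v \<alpha> (x (Suc n) *\<^sub>v basis (Suc n))"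
      using xc[OF n] tx[of n] trunc_Suc[OF xc Suc.prems] by (simp only: alpha_add smul_closed basis_closed)
    also have "\<dots> = trunc (\<lambda>i. sigma (x i)) n +\<^sub>v sigma (x (Suc n)) *\<^sub>v basis (Suc n)"
      using Suc.IH Suc.prems by (simp only: alpha_smul_basis[OF n xc[OF n]] Suc_leD)
    also have "\<dots> = trunc (\<lambda>i. sigma (x i)) (Suc n)"
      by (rule trunc_Suc[OF _ Suc.prems, symmetric]) (rule sigma_closed[OF xc])
    finally show ?case .
  qed
  from this[of d] have "\<alpha> (trunc x d) i = sigma (x i)"
    using i by (simp add: trunc_def)
  moreover have "trunc x d = x"
    using x tx[of d] by (intro point_eqI) (auto simp: trunc_def)
  ultimately show ?thesis
    by simp
qed

section \<open>Compatibility of \<open>sigma\<close> with the field operations\<close>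

lemma sigma_add:
  assumes [simp]: "s \<in> carrier F" "t \<in> carrier F"
  shows "sigma (s \<oplus> t) = sigma s \<oplus> sigma t"
proof -
  have "\<alpha> ((s \<oplus> t) *\<^sub>v basis 1) = \<alpha> (s *\<^sub>v basis 1) +\<^sub>v \<alpha> (t *\<^sub>v basis 1)"
    by (simp add: smul_add_left alpha_add)
  from fun_cong[OF this, of 1] show ?thesis
    using one_mem by (simp add: sigma_def coords)
qed

lemma sigma_one [simp]: "sigma \<one> = \<one>"
  using one_mem by (simp add: sigma_def alpha_basis coords)

lemma sigma_zero [simp]: "sigma \<zero> = \<zero>"
  using one_mem by (simp add: sigma_def coords)

text \<open>The image of \<open>s\<close> times \<open>?x\<close> is \<open>r\<close> times the
  image of \<open>?x\<close>. The first coordinate identifies \<open>r\<close> as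
  \<open>sigma s\<close>, and the second is then the claim.\<close>

lemma sigma_mult:
  assumes [simp]: "s \<in> carrier F" "t \<in> carrier F"
  shows "sigma (s \<otimes> t) = sigma s \<otimes> sigma t"
proof -
  let ?x = "basis 1 +\<^sub>v t *\<^sub>v basis 2"
  obtain r where r: "r \<in> carrier F" "\<alpha> (s *\<^sub>v ?x) = r *\<^sub>v \<alpha> ?x"
    using alpha_smul[of ?x s] by auto
  have eq: "sigma ((s *\<^sub>v ?x) i) = r \<otimes> sigma (?x i)" if "i \<in> {1..d}" for i
    using fun_cong[OF r(2), of i] that by (simp add: alpha_coords coords(4))
  have "sigma s = r" "sigma (s \<otimes> t) = r \<otimes> sigma t"
    using eq[OF one_mem] eq[OF two_mem] one_mem two_mem r by (simp_all add: coords)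
  then show ?thesis
    by simp
qed

lemma sigma_inj:
  assumes "s \<in> carrier F" "t \<in> carrier F" "sigma s = sigma t"
  shows "s = t"
proof -
  have "s *\<^sub>v basis 1 = t *\<^sub>v basis 1"
    using assms one_mem by (intro alpha_inj[of "s *\<^sub>v basis 1" "t *\<^sub>v basis 1"])
      (simp_all only: alpha_smul_basis smul_closed basis_closed)
  from fun_cong[OF this, of 1] show ?thesis
    using assms one_mem by (simp add: coords)
qed

lemma sigma_surj:
  assumes "t \<in> carrier F" obtains s where "s \<in> carrier F" "t = sigma s"
proof -
  obtain x where x: "x \<in> V" "t *\<^sub>v basis 1 = \<alpha> x"
    using assms alpha_surj[of "t *\<^sub>v basis 1"] by auto
  have "t = (t *\<^sub>v basis 1) 1"
    using assms one_mem by (simp add: coords)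
  also have "\<dots> = sigma (x 1)"
    unfolding x(2) by (rule alpha_coords[OF x(1) one_mem])
  finally have "t = sigma (x 1)" .
  then show ?thesis
    using that coord_closed[OF x(1) one_mem] by blast
qed

section \<open>Order and the function \<open>expo\<close>\<close>

lemma sigma_unit_interval:
  assumes "t \<in> unit_interval" shows "sigma t \<in> unit_interval"
proof -
  have t: "t \<in> carrier F"
    using assms by (rule unit_interval_closed)
  \<comment> \<open>Betweenness of two points fixed by \<open>\<alpha>\<close> expresses membership
    in the unit interval.\<close>
  have "bw origin (t *\<^sub>v basis 1) (basis 1)"
    using assms t by (auto simp: bw_iff line_pt_origin intro!: bexI[of _ t])
  then have "bw origin (sigma t *\<^sub>v basis 1) (basis 1)"
    using t alpha_bw[of origin "t *\<^sub>v basis 1" "basis 1"] one_mem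
    by (simp add: alpha_smul_basis alpha_basis)
  then obtain u where u: "u \<in> unit_interval" "sigma t *\<^sub>v basis 1 = u *\<^sub>v basis 1"
    using t by (auto simp: bw_iff line_pt_origin unit_interval_closed)
  from fun_cong[OF u(2), of 1] show ?thesis
    using u(1) t one_mem by (simp add: coords unit_interval_closed)
qed

text \<open>Injectivity keeps nonzero elements of the unit interval positive. An element beyond 1
  has its inverse there, and positivity passes back from the inverse.\<close>

lemma sigma_pos:
  assumes "t \<in> carrier F" "lt F \<zero> t" shows "lt F \<zero> (sigma t)"
proof -
  have pos: "lt F \<zero> (sigma u)" if u: "u \<in> unit_interval" "u \<noteq> \<zero>" for u
  proof -
    have "sigma u \<noteq> \<zero>"
      using sigma_inj[of u \<zero>] u unit_interval_closed by auto
    then show ?thesis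
      using sigma_unit_interval[OF u(1)] by (auto simp: unit_interval_def le_def)
  qed
  have "t \<noteq> \<zero>"
    using assms lt_irrefl[of \<zero>] by auto
  show ?thesis
  proof (cases "lt F \<one> t")
    case True
    obtain s where s: "s \<in> carrier F" "t \<otimes> s = \<one>" "s \<otimes> t = \<one>"
      using obtain_inverse[of t] assms \<open>t \<noteq> \<zero>\<close> by auto
    have "lt F \<zero> (sigma s)"
      using True s assms inverse_unit_interval[of t s] by (intro pos) auto
    moreover have "sigma s \<otimes> sigma t = \<one>"
      using s assms sigma_mult[of s t] by simp
    ultimately show ?thesis
      using s assms pos_inverse[of "sigma s" "sigma t"] by simp
  next
    case False
    then have "t \<in> unit_interval"
      using assms lt_total[of \<one> t] by (auto simp: unit_interval_def le_def)
    then show ?thesis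
      using pos \<open>t \<noteq> \<zero>\<close> by blast
  qed
qed

lemma sigma_lt:
  assumes [simp]: "s \<in> carrier F" "t \<in> carrier F" and "lt F s t"
  shows "lt F (sigma s) (sigma t)"
proof -
  have "lt F \<zero> (sigma (t \<ominus> s))"
    using assms lt_iff_minus[of s t] by (intro sigma_pos) auto
  moreover have "sigma (t \<ominus> s) = sigma t \<ominus> sigma s"
  proof -
    have "t \<ominus> s \<oplus> s = t"
      using assms(1,2) by algebra
    then have "sigma (t \<ominus> s) \<oplus> sigma s = sigma t"
      using sigma_add[of "t \<ominus> s" s] by simp
    moreover have "sigma (t \<ominus> s) = sigma (t \<ominus> s) \<oplus> sigma s \<ominus> sigma s"
      using sigma_closed[of s] sigma_closed[of "t \<ominus> s"] minus_closed[of t s] assms(1,2) by algebra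
    ultimately show ?thesis
      by simp
  qed
  ultimately show ?thesis
    using lt_iff_minus[of "sigma s" "sigma t"] by simp
qed

text \<open>The pair with \<open>t\<close> on the first axis and \<open>expo F t\<close> on the
  second satisfies the relation; so does its image, which carries \<open>sigma\<close> of both
  values on the same axes.\<close>

lemma sigma_expo:
  assumes [simp]: "t \<in> carrier F"
  shows "sigma (expo F t) = expo F (sigma t)"
proof -
  have e [simp]: "expo F t \<in> carrier F"
    by (simp add: expo_closed)
  have "Gamma_exp d F (t *\<^sub>v basis 1) (expo F t *\<^sub>v basis 2)"
    using one_mem two_mem by (simp add: Gamma_exp_def coords)
  then have "Gamma_exp d F (\<alpha> (t *\<^sub>v basis 1)) (\<alpha> (expo F t *\<^sub>v basis 2))"
    by (intro alpha_Gamma) auto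
  then show ?thesis
    using one_mem two_mem by (simp add: alpha_smul_basis Gamma_exp_def coords)
qed

lemma sigma_Aut: "sigma \<in> field_Aut F"
proof -
  have "bij_betw sigma (carrier F) (carrier F)"
    unfolding bij_betw_def
  proof
    show "inj_on sigma (carrier F)"
      by (rule inj_onI) (rule sigma_inj)
    show "sigma ` carrier F = carrier F"
      using sigma_closed by (auto elim: sigma_surj)
  qed
  \<comment> \<open>\<open>Bij\<close> also demands extensionality, which the restriction in the
    definition of \<open>sigma\<close> supplies.\<close>
  then have bij: "sigma \<in> Bij (carrier F)"
    by (simp add: Bij_def sigma_def)
  have hom: "sigma \<in> ring_hom F F"
    by (rule ring_hom_memI) (simp_all add: sigma_add sigma_mult)
  \<comment> \<open>A strictly increasing map reflects a total order, since the two other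
    alternatives contradict \<open>lt F (sigma x) (sigma y)\<close>.\<close>
  have lt_rev: "lt F x y" if "x \<in> carrier F" "y \<in> carrier F" "lt F (sigma x) (sigma y)" for x y
    using that lt_total[of x y] sigma_lt[of y x] lt_asym[of "sigma x" "sigma y"] lt_irrefl by auto
  show ?thesis
    unfolding field_Aut_def by (intro CollectI conjI ballI iffI) (rule bij hom sigma_lt sigma_expo lt_rev; assumption)+
qed

lemma alpha_eq: "\<alpha> = compose V (\<lambda>x\<in>V. x) (coordinatewise d F sigma)"
proof (rule extensionalityI)
  show "\<alpha> \<in> extensional V"
    using alpha_Bij by (simp add: Bij_def)
  fix x assume x: "x \<in> V"
  then have "(\<lambda>i\<in>{1..d}. sigma (x i)) \<in> V"
    by (auto simp: pow_space_def PiE_iff)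
  moreover have "\<alpha> x = (\<lambda>i\<in>{1..d}. sigma (x i))"
    using x calculation by (intro point_eqI) (auto simp: alpha_coords)
  ultimately show "\<alpha> x = compose V (\<lambda>x\<in>V. x) (coordinatewise d F sigma) x"
    using x by (simp add: compose_eq coordinatewise_def)
qed (rule compose_extensional)

end

theorem proposition7p5:
  fixes F :: "'a exp_field" and d :: nat
  assumes "d \<ge> 2" and "ordered_exp_field F"
  shows "semilinearly_faithful TYPE('i) d (G_exp d) F"
  unfolding semilinearly_faithful_def Let_def
proof (intro allI impI ballI)
  fix I :: "'i set" and U \<alpha>
  assume "ultrafilter_on I U" and aut: "\<alpha> \<in> Aut (G_exp d (ultrapower I U F))"
  then interpret ultrapower_setup F I U
    using assms by (simp add: ultrapower_setup_def ultrapower_setup_axioms_def)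
  \<comment> \<open>The geometric argument runs over the ultrapower itself, which is again an
    ordered field with a unary function.\<close>
  interpret K: geometry_automorphism "ultrapower I U F" d \<alpha>
    using ordered_exp_field_ultrapower assms(1) aut
    by (simp add: geometry_automorphism_def coordinate_space_def coordinate_space_axioms_def
        geometry_automorphism_axioms_def)
  show "\<exists>A\<in>AffAut d K (G_exp d K). \<exists>\<sigma>\<in>field_Aut K. \<alpha> = compose (pow_space d K) A (coordinatewise d K \<sigma>)"
    using K.identity_AffAut K.sigma_Aut K.alpha_eq by blast
qed

end
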